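(* Let $n,d\ge 1$ be integers, let $f_1,\dots,f_n,h:\mathbb{R}^d\to\mathbb{R}$ be continuously differentiable, and put $F:=\frac1n\sum_{i=1}^n f_i$ and $\psi:=F+h$. Assume that $f_i$ is $L_i$-smooth for each $i=1,\dots,n$, that $h$ is $L_h$-smooth, and that $\psi$ is $\lambda$-strongly convex, where $L_1,\dots,L_n,L_h,\lambda>0$. Let $\boldsymbol{x}^*$ be the minimizer of $\psi$ over $\mathbb{R}^d$. Define (batch size $B=1$ and uniform sampling $p_j=1/n$, $j=1,\dots,n$) $$s_F:=\frac{2}{\lambda^2 n}\sum_{i=1}^{n}L_i^2,\qquad \sigma_F:=\frac1n\sum_{i=1}^n\|\nabla f_i(\boldsymbol{x}^* )\|_2^2-\|\nabla F(\boldsymbol{x}^* )\|_2^2.$$ Let $$0<\eta\le\min\left\{\frac{2}{(s_F+1)\left(\frac1n\sum_{i=1}^n L_i+L_h+\lambda\right)},\ \frac{1}{2\left(\max_{1\le i\le n}L_i+L_h\right)}\right\},$$ and set $$q_1=\frac{2\eta\lambda\left(\frac1n\sum_{i=1}^n L_i+L_h\right)}{\frac1n\sum_{i=1}^n L_i+L_h+\lambda},\quad R_1=\frac{2\eta^2\sigma_F}{q_1},\quad q_2=\eta\lambda,\quad R_2=\frac{2\eta}{\lambda n}\sum_{i=1}^n\|\nabla f_i(\boldsymbol{x}^* )+\nabla h(\boldsymbol{x}^* )\|_2^2.$$ Then $q_1\ge q_2$ and $R_1\le R_2$. Furthermore, if $\frac1n\sum_{i=1}^n L_i+L_h>\lambda$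 and $\sigma_F>0$, then $q_1>q_2$ and $R_1<R_2$.
   Context: A continuously differentiable function $g:\mathbb{R}^d\to\mathbb{R}$ is called $L$-smooth ($L>0$) if $\|\nabla g(\boldsymbol{x})-\nabla g(\boldsymbol{y})\|_2\le L\|\boldsymbol{x}-\boldsymbol{y}\|_2$ for all $\boldsymbol{x},\boldsymbol{y}\in\mathbb{R}^d$, and $\lambda$-strongly convex ($\lambda>0$) if $\boldsymbol{x}\mapsto g(\boldsymbol{x})-\frac{\lambda}{2}\|\boldsymbol{x}\|_2^2$ is convex. The pairs $(q_1,R_1)$ and $(q_2,R_2)$ are the rates and radii in two bounds of the form $\mathbb{E}[\|\boldsymbol{x}_{K+1}-\boldsymbol{x}^*\|_2^2]\le(1-q)^K\|\boldsymbol{x}_1-\boldsymbol{x}^*\|_2^2+R$ for SGD with constant step size $\eta$, batch size $1$ and uniform sampling applied to $\psi=F+h$. *)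

theory Defs
  imports "HOL-Analysis.Analysis"
begin

(* Only meaningful where g is differentiable; see gradient_eq and GDERIV_gradient below. *)
definition gradient :: "('a::euclidean_space \<Rightarrow> real) \<Rightarrow> 'a \<Rightarrow> 'a" where
  "gradient g x = (THE D. GDERIV g x :> D)"

definition continuously_differentiable :: "('a::euclidean_space \<Rightarrow> real) \<Rightarrow> bool" where
  "continuously_differentiable g \<longleftrightarrow>
     (\<forall>x. g differentiable (at x)) \<and> continuous_on UNIV (gradient g)"

definition smooth :: "real \<Rightarrow> ('a::euclidean_space \<Rightarrow> real) \<Rightarrow> bool" where
  "smooth L g \<longleftrightarrow> 0 < L \<and> continuously_differentiable g \<and>
     (\<forall>x y. norm (gradient g x - gradient g y) \<le> L * norm (x - y))"

definition strongly_convex :: "real \<Rightarrow> ('a::euclidean_space \<Rightarrow> real) \<Rightarrow> bool" where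
  "strongly_convex lam g \<longleftrightarrow> 0 < lam \<and> continuously_differentiable g \<and>
     convex_on UNIV (\<lambda>x. g x - lam / 2 * (norm x)\<^sup>2)"

lemma gradient_eq:
  fixes g :: "'a::euclidean_space \<Rightarrow> real"
  assumes "GDERIV g x :> D"
  shows "gradient g x = D"
  unfolding gradient_def
proof (rule the_equality, rule assms)
  fix D' assume "GDERIV g x :> D'"
  then have "(\<lambda>h. inner h D') = (\<lambda>h. inner h D)"
    using assms has_derivative_unique unfolding gderiv_def by blast
  then show "D' = D"
    by (metis vector_eq_ldot)
qed

lemma GDERIV_gradient:
  fixes g :: "'a::euclidean_space \<Rightarrow> real"
  assumes "g differentiable (at x)"
  shows "GDERIV g x :> gradient g x"
proof -
  obtain g' where g': "(g has_derivative g') (at x)"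
    using assms unfolding differentiable_def by blast
  then have "linear g'"
    by (rule has_derivative_linear)
  then have "g' h = inner h (\<Sum>b\<in>Basis. g' b *\<^sub>R b)" for h
    by (subst euclidean_representation[symmetric, of h])
       (simp add: linear_sum linear_scale inner_sum_right inner_sum_left mult.commute)
  then have "g' = (\<lambda>h. inner h (\<Sum>b\<in>Basis. g' b *\<^sub>R b))"
    by blast
  then have "GDERIV g x :> (\<Sum>b\<in>Basis. g' b *\<^sub>R b)"
    using g' unfolding gderiv_def by simp
  then show ?thesis
    using gradient_eq by metis
qed

end

theory Submission
  imports Defs
begin

text \<open>
  Let \<open>M\<close> be the mean of the \<open>L\<^sub>i\<close> plus \<open>L\<^sub>h\<close>. The gradient of \<open>\<psi>\<close> is \<open>M\<close>-Lipschitz and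
  strongly monotone with constant \<open>lam\<close>, so \<open>lam \<le> M\<close>, which is equivalent to \<open>q\<^sub>1 \<ge> q\<^sub>2\<close>. Since
  \<open>\<nabla>h = -\<nabla>F\<close> at the minimizer, the sum in \<open>R\<^sub>2\<close> is a variance and equals \<open>n \<sigma>\<^sub>F\<close>; hence
  \<open>R\<^sub>1 = \<eta> \<sigma>\<^sub>F (M + lam) / (lam M)\<close> and \<open>R\<^sub>2 = 2 \<eta> \<sigma>\<^sub>F / lam\<close>, and \<open>lam \<le> M\<close> gives the comparison.
\<close>

lemma GDERIV_sum:
  assumes "\<And>i. i \<in> I \<Longrightarrow> GDERIV (f i) x :> D i"
  shows "GDERIV (\<lambda>x. \<Sum>i\<in>I. f i x) x :> (\<Sum>i\<in>I. D i)"
  using has_derivative_sum[of I f "\<lambda>i h. inner h (D i)" "at x"] assms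
  by (simp add: gderiv_def inner_sum_right)

lemma GDERIV_cmult:
  assumes "GDERIV f x :> D"
  shows "GDERIV (\<lambda>x. c * f x) x :> c *\<^sub>R D"
  using has_derivative_mult_right[of f "\<lambda>h. inner h D" "at x" c] assms
  by (simp add: gderiv_def)

lemma GDERIV_half_norm_square:
  "GDERIV (\<lambda>x. c / 2 * (norm x)\<^sup>2) x :> c *\<^sub>R x"
  unfolding gderiv_def power2_norm_eq_inner
  by (auto intro!: derivative_eq_intros simp: inner_commute algebra_simps)

text \<open>The derivative at a minimum is the zero functional; evaluating it at \<open>D\<close>
  itself gives \<open>inner D D = 0\<close>.\<close>

lemma GDERIV_minimum:
  assumes "GDERIV f x :> D" and "\<And>y. f x \<le> f y"
  shows "D = 0"
proof -
  have "(\<lambda>h. inner h D) = (\<lambda>h. 0)"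
    using assms has_derivative_local_min[of f "\<lambda>h. inner h D" x]
    unfolding gderiv_def by (auto simp: fun_eq_iff)
  then show ?thesis
    by (metis inner_eq_zero_iff)
qed

text \<open>Restricting \<open>f\<close> to the line through \<open>x\<close> and \<open>y\<close>
  reduces the claim to the tangent inequality for a convex function of one real variable, taken
  between the parameters 0 and 1.\<close>

lemma convex_on_imp_above_tangent_GDERIV:
  fixes f :: "'a::real_inner \<Rightarrow> real"
  assumes conv: "convex_on UNIV f" and D: "GDERIV f x :> D"
  shows "f y \<ge> f x + inner (y - x) D"
proof -
  define g where "g = (\<lambda>t. f (x + t *\<^sub>R (y - x)))"
  have "convex_on UNIV g"
  proof (rule convex_onI)
    fix t a b :: real
    assume "0 < t" "t < 1"
    moreover have "x + ((1 - t) *\<^sub>R a + t *\<^sub>R b) *\<^sub>R (y - x)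
        = (1 - t) *\<^sub>R (x + a *\<^sub>R (y - x)) + t *\<^sub>R (x + b *\<^sub>R (y - x))"
      by (simp add: algebra_simps)
    ultimately show "g ((1 - t) *\<^sub>R a + t *\<^sub>R b) \<le> (1 - t) * g a + t * g b"
      using convex_onD[OF conv, of t "x + a *\<^sub>R (y - x)" "x + b *\<^sub>R (y - x)"]
      unfolding g_def by simp
  qed simp
  moreover have "(g has_real_derivative inner (y - x) D) (at 0)"
  proof -
    have "((\<lambda>t. x + t *\<^sub>R (y - x)) has_derivative (\<lambda>t. t *\<^sub>R (y - x))) (at 0)"
      by (auto intro!: derivative_eq_intros)
    then have "(g has_derivative (\<lambda>t. inner (t *\<^sub>R (y - x)) D)) (at 0)"
      unfolding g_def
      by (rule has_derivative_compose) (use D in \<open>simp add: gderiv_def\<close>)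
    then show ?thesis
      by (simp add: has_field_derivative_def mult.commute[of _ "inner (y - x) D"])
  qed
  ultimately have "g 1 - g 0 \<ge> inner (y - x) D * (1 - 0)"
    by (intro convex_on_imp_above_tangent[where A = UNIV]) auto
  then show ?thesis
    by (simp add: g_def)
qed

text \<open>The tangent inequalities of the convex function \<open>G\<close> at \<open>x\<close> and
  at \<open>y\<close> are added: the values of \<open>G\<close> cancel, which leaves monotonicity of
  the gradient of \<open>G\<close>, and its part \<open>- lam *\<^sub>R z\<close> accounts for the
  square on the left.\<close>

lemma strongly_convex_gradient_strongly_monotone:
  assumes "strongly_convex lam g"
  shows "lam * (norm (x - y))\<^sup>2 \<le> inner (gradient g x - gradient g y) (x - y)"
proof -
  define G where "G = (\<lambda>x. g x - lam / 2 * (norm x)\<^sup>2)"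
  have conv: "convex_on UNIV G"
    and diff: "g differentiable (at z)" for z
    using assms by (auto simp: strongly_convex_def continuously_differentiable_def G_def)
  have D: "GDERIV G z :> gradient g z - lam *\<^sub>R z" for z
    unfolding G_def
    by (intro GDERIV_diff GDERIV_gradient GDERIV_half_norm_square diff)
  from convex_on_imp_above_tangent_GDERIV[OF conv D, of x y]
    convex_on_imp_above_tangent_GDERIV[OF conv D, of y x]
  show ?thesis
    by (simp add: power2_norm_eq_inner inner_diff_left inner_diff_right inner_commute
        algebra_simps)
qed

text \<open>Strong monotonicity bounds the change of the gradient along a vector from below,
  Cauchy-Schwarz with the Lipschitz bound from above. A basis vector serves as the vector, since its
  norm 1 leaves just the two constants.\<close>

lemma strongly_convex_le_Lipschitz:
  fixes g :: "'a::euclidean_space \<Rightarrow> real"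
  assumes "strongly_convex lam g"
    and Lip: "\<And>x y. norm (gradient g x - gradient g y) \<le> M * norm (x - y)"
  shows "lam \<le> M"
proof -
  obtain b :: 'a where b: "norm b = 1"
    using norm_Basis nonempty_Basis by blast
  have "lam \<le> inner (gradient g b - gradient g 0) b"
    using strongly_convex_gradient_strongly_monotone[OF assms(1), of b 0] b by simp
  also have "\<dots> \<le> norm (gradient g b - gradient g 0) * norm b"
    by (rule norm_cauchy_schwarz)
  also have "\<dots> \<le> M"
    using Lip[of b 0] b by simp
  finally show ?thesis .
qed

text \<open>This is the identity of the two formulas for a variance: after expanding the squares,
  the cross term is \<open>-2 * real n * (norm m)\<^sup>2\<close>, because the vectors sum to
  \<open>real n *\<^sub>R m\<close>.\<close>

lemma sum_norm_diff_mean_square: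
  fixes v :: "nat \<Rightarrow> 'a::real_inner"
  assumes "n \<ge> 1"
  defines "m \<equiv> (1 / real n) *\<^sub>R (\<Sum>i=1..n. v i)"
  shows "(\<Sum>i=1..n. (norm (v i - m))\<^sup>2)
    = real n * ((1 / real n) * (\<Sum>i=1..n. (norm (v i))\<^sup>2) - (norm m)\<^sup>2)"
proof -
  have s: "(\<Sum>i=1..n. v i) = real n *\<^sub>R m"
    using assms by simp
  have "(norm (v i - m))\<^sup>2 = (norm (v i))\<^sup>2 - 2 * inner (v i) m + (norm m)\<^sup>2" for i
    by (simp add: power2_norm_eq_inner inner_diff_left inner_diff_right inner_commute)
  then have "(\<Sum>i=1..n. (norm (v i - m))\<^sup>2)
      = (\<Sum>i=1..n. (norm (v i))\<^sup>2) - 2 * inner (\<Sum>i=1..n. v i) m + real n * (norm m)\<^sup>2"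
    by (simp add: sum.distrib sum_subtractf sum_distrib_left inner_sum_left)
  also have "\<dots> = (\<Sum>i=1..n. (norm (v i))\<^sup>2) - real n * (norm m)\<^sup>2"
    unfolding s by (simp add: power2_norm_eq_inner)
  finally show ?thesis
    using assms(1) by (simp add: algebra_simps)
qed

theorem theorem4p1:
  fixes n :: nat
    and f :: "nat \<Rightarrow> real ^ 'd \<Rightarrow> real"
    and h F \<psi> :: "real ^ 'd \<Rightarrow> real"
    and L :: "nat \<Rightarrow> real"
    and L\<^sub>h lam \<eta> s\<^sub>F \<sigma>\<^sub>F q\<^sub>1 R\<^sub>1 q\<^sub>2 R\<^sub>2 :: real
    and xs :: "real ^ 'd"
  defines "F \<equiv> \<lambda>x. (1 / real n) * (\<Sum>i=1..n. f i x)"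
    and "\<psi> \<equiv> \<lambda>x. F x + h x"
    and "s\<^sub>F \<equiv> 2 / (lam\<^sup>2 * real n) * (\<Sum>i=1..n. (L i)\<^sup>2)"
    and "\<sigma>\<^sub>F \<equiv> (1 / real n) * (\<Sum>i=1..n. (norm (gradient (f i) xs))\<^sup>2)
                - (norm (gradient F xs))\<^sup>2"
    and "q\<^sub>1 \<equiv> 2 * \<eta> * lam * ((1 / real n) * (\<Sum>i=1..n. L i) + L\<^sub>h)
                / ((1 / real n) * (\<Sum>i=1..n. L i) + L\<^sub>h + lam)"
    and "R\<^sub>1 \<equiv> 2 * \<eta>\<^sup>2 * \<sigma>\<^sub>F / q\<^sub>1"
    and "q\<^sub>2 \<equiv> \<eta> * lam"
    and "R\<^sub>2 \<equiv> 2 * \<eta> / (lam * real n)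
                * (\<Sum>i=1..n. (norm (gradient (f i) xs + gradient h xs))\<^sup>2)"
  assumes "n \<ge> 1"
    and "\<forall>i\<in>{1..n}. continuously_differentiable (f i)"
    and "continuously_differentiable h"
    and "\<forall>i\<in>{1..n}. L i > 0" and "L\<^sub>h > 0" and "lam > 0"
    and "\<forall>i\<in>{1..n}. smooth (L i) (f i)"
    and "smooth L\<^sub>h h"
    and "strongly_convex lam \<psi>"
    and "is_arg_min \<psi> (\<lambda>_. True) xs"
    and "0 < \<eta>"
    and "\<eta> \<le> min (2 / ((s\<^sub>F + 1) * ((1 / real n) * (\<Sum>i=1..n. L i) + L\<^sub>h + lam)))
                 (1 / (2 * (Max (L ` {1..n}) + L\<^sub>h)))"
  shows "q\<^sub>1 \<ge> q\<^sub>2 \<and> R\<^sub>1 \<le> R\<^sub>2 \<and>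
    ((1 / real n) * (\<Sum>i=1..n. L i) + L\<^sub>h > lam \<and> \<sigma>\<^sub>F > 0 \<longrightarrow> q\<^sub>1 > q\<^sub>2 \<and> R\<^sub>1 < R\<^sub>2)"
proof -
  define M where "M = (1 / real n) * (\<Sum>i=1..n. L i) + L\<^sub>h"
  have diff: "g differentiable (at x)" if "continuously_differentiable g"
    for g :: "real ^ 'd \<Rightarrow> real" and x
    using that by (simp add: continuously_differentiable_def)
  have GF: "GDERIV F x :> (1 / real n) *\<^sub>R (\<Sum>i=1..n. gradient (f i) x)" for x
    unfolding F_def
    using \<open>\<forall>i\<in>{1..n}. continuously_differentiable (f i)\<close>
    by (intro GDERIV_cmult GDERIV_sum GDERIV_gradient diff) auto
  have G\<psi>: "GDERIV \<psi> x :> gradient F x + gradient h x" for x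
    unfolding \<psi>_def gradient_eq[OF GF]
    by (intro GDERIV_add GF GDERIV_gradient diff \<open>continuously_differentiable h\<close>)
  \<comment> \<open>The Lipschitz constants of the summands of \<open>\<psi>\<close> add up to
    \<open>M\<close> by the triangle inequality.\<close>
  have "lam \<le> M"
  proof (rule strongly_convex_le_Lipschitz[OF \<open>strongly_convex lam \<psi>\<close>])
    fix x y :: "real ^ 'd"
    let ?d = "\<lambda>g. gradient g x - gradient g y"
    have "norm (\<Sum>i=1..n. ?d (f i)) \<le> (\<Sum>i=1..n. L i * norm (x - y))"
      using \<open>\<forall>i\<in>{1..n}. smooth (L i) (f i)\<close>
      by (intro sum_norm_le) (simp add: smooth_def)
    then have "norm (?d F) \<le> (1 / real n) * (\<Sum>i=1..n. L i) * norm (x - y)"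
      by (simp add: gradient_eq[OF GF] sum_distrib_right divide_right_mono
          flip: scaleR_diff_right sum_subtractf)
    moreover have "norm (?d h) \<le> L\<^sub>h * norm (x - y)"
      using \<open>smooth L\<^sub>h h\<close> by (simp add: smooth_def)
    moreover have "norm (?d \<psi>) \<le> norm (?d F) + norm (?d h)"
      unfolding gradient_eq[OF G\<psi>] by (rule norm_diff_triangle_ineq)
    ultimately show "norm (?d \<psi>) \<le> M * norm (x - y)"
      by (simp add: M_def distrib_right)
  qed
  have "gradient F xs + gradient h xs = 0"
    using \<open>is_arg_min \<psi> (\<lambda>_. True) xs\<close>
    by (intro GDERIV_minimum[OF G\<psi>]) (auto simp: is_arg_min_linorder)
  \<comment> \<open>This turns each term of the sum in \<open>R\<^sub>2\<close> into the deviation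
    of \<open>gradient (f i) xs\<close> from the mean \<open>gradient F xs\<close>.\<close>
  then have "gradient h xs = - gradient F xs"
    by (simp add: eq_neg_iff_add_eq_0 add.commute)
  then have var: "(\<Sum>i=1..n. (norm (gradient (f i) xs + gradient h xs))\<^sup>2) = real n * \<sigma>\<^sub>F"
    using sum_norm_diff_mean_square[OF \<open>n \<ge> 1\<close>, of "\<lambda>i. gradient (f i) xs"]
    by (simp add: \<sigma>\<^sub>F_def gradient_eq[OF GF])
  \<comment> \<open>As a sum of squares, the variance is nonnegative; the non-strict comparison of
    the radii relies on this sign.\<close>
  have "0 \<le> real n * \<sigma>\<^sub>F"
    unfolding var[symmetric] by (intro sum_nonneg) simp
  then have \<sigma>: "0 \<le> \<sigma>\<^sub>F"
    using \<open>n \<ge> 1\<close> by (simp add: zero_le_mult_iff)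
  have pos: "0 < lam" "0 < \<eta>" "0 < M"
    using \<open>lam > 0\<close> \<open>0 < \<eta>\<close> \<open>lam \<le> M\<close> by auto
  \<comment> \<open>Splitting \<open>2 * M\<close> as \<open>(M + lam) + (M - lam)\<close> isolates
    a gap with the sign of \<open>M - lam\<close>, so that one formula serves both the weak and the
    strict inequality. The same splitting yields \<open>R2\<close> below.\<close>
  have q1: "q\<^sub>1 = q\<^sub>2 + q\<^sub>2 * (M - lam) / (M + lam)"
    using pos unfolding q\<^sub>1_def q\<^sub>2_def M_def[symmetric] by (simp add: field_simps)
  have R1: "R\<^sub>1 = \<eta> * \<sigma>\<^sub>F * (M + lam) / (lam * M)"
    using pos unfolding R\<^sub>1_def q\<^sub>1_def M_def[symmetric]
    by (simp add: field_simps power2_eq_square)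
  have R2: "R\<^sub>2 = R\<^sub>1 + \<eta> * \<sigma>\<^sub>F * (M - lam) / (lam * M)"
    using pos \<open>n \<ge> 1\<close> unfolding R\<^sub>2_def var R1 by (simp add: field_simps)
  have "0 < q\<^sub>2"
    using pos by (simp add: q\<^sub>2_def)
  then have "q\<^sub>1 \<ge> q\<^sub>2" "R\<^sub>1 \<le> R\<^sub>2"
    using pos \<sigma> \<open>lam \<le> M\<close> by (simp_all add: q1 R2)
  moreover have "q\<^sub>1 > q\<^sub>2" "R\<^sub>1 < R\<^sub>2" if "M > lam" "\<sigma>\<^sub>F > 0"
    using pos that \<open>0 < q\<^sub>2\<close> by (simp_all add: q1 R2)
  ultimately show ?thesis
    unfolding M_def[symmetric] by blast
qed

end
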